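(* There is a $2$-adic integer $K$ such that, for all positive integers $d$ and all integers $e>d$, $$\operatorname{uns}(e,d)+K\equiv \operatorname{stab}(e+1,d)\pmod{2^d}.$$
   Context: For a positive integer $n$, $\nu(n)$ is the exponent of $2$ in the prime factorization of $n$, and $\operatorname{od}(n)=n/2^{\nu(n)}$ is the odd part of $n$. The notation $2^e!$ means $(2^e)!$. Let $z$ be the $2$-adic integer $\lim_{e\to\infty}\operatorname{od}(2^e!)$ ($2$-adic limit); it is known to exist and to satisfy $z\equiv\operatorname{od}(2^{e-1}!)\pmod{2^e}$ for all $e\ge3$. The bit in position $i$ of a ($2$-adic) integer is the coefficient of $2^i$ in its binary expansion. $\operatorname{uns}(e,d)=\sum_{i=0}^{d-1}u_i2^i$, where $u_i$ is the bit of $\operatorname{od}(2^e!)$ in position $e+1+i$ (i.e. the number formed by the bits of $\operatorname{od}(2^e!)$ in positions $e+1,\dots,e+d$). $\operatorname{stab}(e+1,d)=\sum_{i=0}^{d-1}s_i2^i$, where $s_i$ is the bit of $z$ in position $e+1+i$ (i.e. the number formed by the bits of $z$ in positions $e+1,\dots,e+d$). *)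

theory Defs
  imports Complex_Main "HOL-Computational_Algebra.Primes"
begin

text \<open>
  The ring of 2-adic integers, as the inverse limit of the rings of integers modulo \<open>2 ^ n\<close>:
  an element is a coherent sequence of residues, each represented in \<open>{0..<2 ^ n}\<close>.
\<close>

typedef two_adic = "{x :: nat \<Rightarrow> int. \<forall>n. x (Suc n) mod 2 ^ n = x n}"
  morphisms residue Abs_two_adic
  by (rule exI[of _ "\<lambda>_. 0"]) simp

setup_lifting type_definition_two_adic

lemma mod_pow_Suc_mod: "(a :: int) mod 2 ^ Suc n mod 2 ^ n = a mod 2 ^ n"
  by (rule mod_mod_cancel) (simp add: le_imp_power_dvd)

lemma residue_Suc_mod: "residue x (Suc n) mod 2 ^ n = residue x n"
  using residue[of x] by simp

lemma residue_mod [simp]: "residue x n mod 2 ^ n = residue x n"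
  by (metis residue_Suc_mod mod_mod_trivial)

lemma residue_0 [simp]: "residue x 0 = 0"
  using residue_mod[of x 0] by simp

lemma residue_mod_le: "m \<le> n \<Longrightarrow> residue x n mod 2 ^ m = residue x m"
proof (induction n)
  case 0
  then show ?case by simp
next
  case (Suc n)
  show ?case
  proof (cases "m = Suc n")
    case False
    then have "m \<le> n" using Suc.prems by simp
    then have "residue x (Suc n) mod 2 ^ m = residue x (Suc n) mod 2 ^ n mod 2 ^ m"
      by (simp add: mod_mod_cancel le_imp_power_dvd)
    then show ?thesis using Suc.IH \<open>m \<le> n\<close> by (simp add: residue_Suc_mod)
  qed (simp del: power_Suc)
qed

lemma two_adic_eqI: "(\<And>n. residue x n = residue y n) \<Longrightarrow> x = y"
  by (simp add: residue_inject[symmetric] fun_eq_iff)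

instantiation two_adic :: comm_ring_1
begin

lift_definition zero_two_adic :: two_adic is "\<lambda>_. 0" by simp

lift_definition one_two_adic :: two_adic is "\<lambda>n. 1 mod 2 ^ n"
  by (rule mod_pow_Suc_mod)

lift_definition plus_two_adic :: "two_adic \<Rightarrow> two_adic \<Rightarrow> two_adic"
  is "\<lambda>x y n. (x n + y n) mod 2 ^ n"
proof -
  fix x y :: "nat \<Rightarrow> int" and n
  assume "\<And>n. x (Suc n) mod 2 ^ n = x n" "\<And>n. y (Suc n) mod 2 ^ n = y n"
  then show "(x (Suc n) + y (Suc n)) mod 2 ^ Suc n mod 2 ^ n = (x n + y n) mod 2 ^ n"
    unfolding mod_pow_Suc_mod by (metis mod_add_eq)
qed

lift_definition uminus_two_adic :: "two_adic \<Rightarrow> two_adic"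
  is "\<lambda>x n. (- x n) mod 2 ^ n"
proof -
  fix x :: "nat \<Rightarrow> int" and n
  assume "\<And>n. x (Suc n) mod 2 ^ n = x n"
  then show "(- x (Suc n)) mod 2 ^ Suc n mod 2 ^ n = (- x n) mod 2 ^ n"
    unfolding mod_pow_Suc_mod by (metis mod_minus_eq)
qed

lift_definition minus_two_adic :: "two_adic \<Rightarrow> two_adic \<Rightarrow> two_adic"
  is "\<lambda>x y n. (x n - y n) mod 2 ^ n"
proof -
  fix x y :: "nat \<Rightarrow> int" and n
  assume "\<And>n. x (Suc n) mod 2 ^ n = x n" "\<And>n. y (Suc n) mod 2 ^ n = y n"
  then show "(x (Suc n) - y (Suc n)) mod 2 ^ Suc n mod 2 ^ n = (x n - y n) mod 2 ^ n"
    unfolding mod_pow_Suc_mod by (metis mod_diff_eq)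
qed

lift_definition times_two_adic :: "two_adic \<Rightarrow> two_adic \<Rightarrow> two_adic"
  is "\<lambda>x y n. (x n * y n) mod 2 ^ n"
proof -
  fix x y :: "nat \<Rightarrow> int" and n
  assume "\<And>n. x (Suc n) mod 2 ^ n = x n" "\<And>n. y (Suc n) mod 2 ^ n = y n"
  then show "(x (Suc n) * y (Suc n)) mod 2 ^ Suc n mod 2 ^ n = (x n * y n) mod 2 ^ n"
    unfolding mod_pow_Suc_mod by (metis mod_mult_eq)
qed

instance
proof
  fix a b c :: two_adic
  show "a + b + c = a + (b + c)"
    by (rule two_adic_eqI) (simp add: plus_two_adic.rep_eq mod_simps algebra_simps)
  show "a + b = b + a"
    by (rule two_adic_eqI) (simp add: plus_two_adic.rep_eq algebra_simps)
  show "0 + a = a"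
    by (rule two_adic_eqI) (simp add: plus_two_adic.rep_eq zero_two_adic.rep_eq)
  show "- a + a = 0"
    by (rule two_adic_eqI)
      (simp add: plus_two_adic.rep_eq zero_two_adic.rep_eq uminus_two_adic.rep_eq mod_simps)
  show "a - b = a + - b"
    by (rule two_adic_eqI)
      (simp add: plus_two_adic.rep_eq minus_two_adic.rep_eq uminus_two_adic.rep_eq mod_simps)
  show "a * b * c = a * (b * c)"
    by (rule two_adic_eqI) (simp add: times_two_adic.rep_eq mod_simps algebra_simps)
  show "a * b = b * a"
    by (rule two_adic_eqI) (simp add: times_two_adic.rep_eq algebra_simps)
  show "1 * a = a"
    by (rule two_adic_eqI) (simp add: times_two_adic.rep_eq one_two_adic.rep_eq mod_simps)
  show "(a + b) * c = a * c + b * c"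
    by (rule two_adic_eqI)
      (simp add: plus_two_adic.rep_eq times_two_adic.rep_eq mod_simps algebra_simps)
  have "residue 0 1 \<noteq> residue 1 1"
    by (simp add: zero_two_adic.rep_eq one_two_adic.rep_eq)
  then show "(0 :: two_adic) \<noteq> 1" by metis
qed

end

lemma residue_of_nat: "residue (of_nat m) n = int m mod 2 ^ n"
  by (induction m) (simp_all add: zero_two_adic.rep_eq one_two_adic.rep_eq
      plus_two_adic.rep_eq mod_simps)

lemma residue_of_int: "residue (of_int m) n = m mod 2 ^ n"
  by (cases m rule: int_diff_cases)
    (simp add: minus_two_adic.rep_eq residue_of_nat mod_simps)

lemma residue_two_power: "residue (2 ^ k) n = 2 ^ k mod 2 ^ n"
  using residue_of_nat[of "2 ^ k" n] by simp

lemma two_power_dvd_two_adic_iff: "2 ^ n dvd (x :: two_adic) \<longleftrightarrow> residue x n = 0"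
proof
  assume "2 ^ n dvd x"
  then obtain y where "x = 2 ^ n * y" by (auto simp: dvd_def)
  then show "residue x n = 0"
    by (simp add: times_two_adic.rep_eq residue_two_power)
next
  assume 0: "residue x n = 0"
  define f where "f m = residue x (n + m) div 2 ^ n" for m
  have dv: "2 ^ n dvd residue x (n + m)" for m
    using residue_mod_le[of n "n + m" x] 0 by (simp add: dvd_eq_mod_eq_0)
  then have fm: "2 ^ n * f m = residue x (n + m)" for m by (simp add: f_def)
  have "f (Suc m) mod 2 ^ m = f m" for m
  proof -
    have "2 ^ n * (f (Suc m) mod 2 ^ m) = (2 ^ n * f (Suc m)) mod (2 ^ n * 2 ^ m)"
      by (rule mult_mod_right)
    also have "\<dots> = residue x (n + m)"
      using residue_mod_le[of "n + m" "n + Suc m" x] by (simp only: fm power_add[symmetric])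
    also have "\<dots> = 2 ^ n * f m" by (rule fm[symmetric])
    finally show ?thesis by simp
  qed
  then have res: "residue (Abs_two_adic f) = f" by (simp add: Abs_two_adic_inverse)
  have "x = 2 ^ n * Abs_two_adic f"
  proof (rule two_adic_eqI)
    fix m
    have "residue (2 ^ n * Abs_two_adic f) m = (2 ^ n * f m) mod 2 ^ m"
      by (simp add: times_two_adic.rep_eq residue_two_power res mod_simps)
    also have "\<dots> = residue x m" using residue_mod_le[of m "n + m" x] by (simp add: fm)
    finally show "residue x m = residue (2 ^ n * Abs_two_adic f) m" by simp
  qed
  then show "2 ^ n dvd x" by (metis dvd_triv_left)
qed

text \<open>
  The 2-adic metric: the distance of distinct \<open>x\<close> and \<open>y\<close> is \<open>2 powr (- v)\<close>, where \<open>v\<close> is the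
  2-adic valuation of \<open>x - y\<close>, the largest \<open>n\<close> such that \<open>2 ^ n\<close> divides \<open>x - y\<close>.
\<close>

definition two_adic_val :: "two_adic \<Rightarrow> nat" where
  "two_adic_val x = (GREATEST n. 2 ^ n dvd x)"

lemma two_adic_val_ge_iff:
  assumes "x \<noteq> 0"
  shows "n \<le> two_adic_val x \<longleftrightarrow> 2 ^ n dvd x"
proof -
  obtain m where m: "residue x m \<noteq> 0"
    using assms two_adic_eqI[of x 0] by (auto simp: zero_two_adic.rep_eq)
  have bound: "k \<le> m" if "2 ^ k dvd x" for k
  proof (rule ccontr)
    assume "\<not> k \<le> m"
    then show False
      using that residue_mod_le[of m k x] m by (simp add: two_power_dvd_two_adic_iff)
  qed
  have "2 ^ two_adic_val x dvd x"
    unfolding two_adic_val_def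
    by (rule GreatestI_nat[where k = 0 and b = m]) (auto intro: bound)
  moreover have "n \<le> two_adic_val x" if "2 ^ n dvd x"
    unfolding two_adic_val_def
    by (rule Greatest_le_nat[where b = m]) (auto intro: bound that)
  ultimately show ?thesis by (meson dvd_trans le_imp_power_dvd)
qed

instantiation two_adic :: metric_space
begin

definition dist_two_adic :: "two_adic \<Rightarrow> two_adic \<Rightarrow> real" where
  "dist x y = (if x = y then 0 else 1 / 2 ^ two_adic_val (x - y))"

definition uniformity_two_adic_def:
  "(uniformity :: (two_adic \<times> two_adic) filter) = (INF e\<in>{0 <..}. principal {(x, y). dist x y < e})"

definition open_two_adic_def:
  "open (U :: two_adic set) = (\<forall>x\<in>U. eventually (\<lambda>(x', y). x' = x \<longrightarrow> y \<in> U) uniformity)"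

lemma dist_two_adic_le_iff: "dist x y \<le> 1 / 2 ^ n \<longleftrightarrow> 2 ^ n dvd x - (y :: two_adic)"
proof (cases "x = y")
  case False
  then have "dist x y \<le> 1 / 2 ^ n \<longleftrightarrow> n \<le> two_adic_val (x - y)"
    by (simp add: dist_two_adic_def field_simps)
  then show ?thesis using False by (simp add: two_adic_val_ge_iff)
qed (simp add: dist_two_adic_def)

instance
proof
  fix x y z :: two_adic
  show "(dist x y = 0) = (x = y)" by (simp add: dist_two_adic_def)
  show "dist x y \<le> dist x z + dist y z"
  proof (cases "x = z \<or> y = z \<or> x = y")
    case True
    have "dist x y = dist y x" "dist x x = 0" "0 \<le> dist x y" for x y :: two_adic
      using dvd_minus_iff[of _ "x - y"]
      by (simp_all add: dist_two_adic_def two_adic_val_def)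
    with True show ?thesis by auto
  next
    case False
    define k where "k = min (two_adic_val (x - z)) (two_adic_val (y - z))"
    have "2 ^ k dvd x - z" "2 ^ k dvd y - z"
      using False by (simp_all add: k_def two_adic_val_ge_iff[symmetric])
    then have "2 ^ k dvd x - y" using dvd_diff[of "2 ^ k" "x - z" "y - z"] by simp
    then have "dist x y \<le> 1 / 2 ^ k" by (simp add: dist_two_adic_le_iff)
    also have "\<dots> \<le> dist x z + dist y z"
      using False by (simp add: dist_two_adic_def k_def min_def)
    finally show ?thesis .
  qed
qed (simp_all add: uniformity_two_adic_def open_two_adic_def)

end

lemma tendsto_two_adic_iff:
  "X \<longlonglongrightarrow> (L :: two_adic) \<longleftrightarrow> (\<forall>n. \<forall>\<^sub>F k in sequentially. 2 ^ n dvd X k - L)"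
proof
  assume lim: "X \<longlonglongrightarrow> L"
  show "\<forall>n. \<forall>\<^sub>F k in sequentially. 2 ^ n dvd X k - L"
  proof
    fix n
    have "\<forall>\<^sub>F k in sequentially. dist (X k) L < 1 / 2 ^ n"
      using lim by (rule tendstoD) simp
    then show "\<forall>\<^sub>F k in sequentially. 2 ^ n dvd X k - L"
      by (rule eventually_mono) (simp add: dist_two_adic_le_iff[symmetric])
  qed
next
  assume ev: "\<forall>n. \<forall>\<^sub>F k in sequentially. 2 ^ n dvd X k - L"
  show "X \<longlonglongrightarrow> L"
  proof (rule tendstoI)
    fix e :: real assume "0 < e"
    then obtain n where "(1 / 2) ^ n < e" using real_arch_pow_inv[of e "1 / 2"] by auto
    then have n: "1 / 2 ^ n < e" by (simp add: power_divide)
    from ev have "\<forall>\<^sub>F k in sequentially. 2 ^ n dvd X k - L" by blast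
    then show "\<forall>\<^sub>F k in sequentially. dist (X k) L < e"
      using n by (elim eventually_mono) (auto simp: dist_two_adic_le_iff[symmetric])
  qed
qed

definition two_adic_bit :: "two_adic \<Rightarrow> nat \<Rightarrow> bool" where
  "two_adic_bit x i = bit (residue x (Suc i)) i"

text \<open>These are indeed the digits of the binary expansion.\<close>

lemma two_adic_bit_sums: "(\<lambda>i. of_bool (two_adic_bit x i) * 2 ^ i) sums x"
proof -
  have partial: "(\<Sum>i<n. of_bool (two_adic_bit x i) * 2 ^ i) = (of_int (residue x n) :: two_adic)"
    for n
  proof (induction n)
    case 0
    show ?case by simp
  next
    case (Suc n)
    have "residue x (Suc n) =
        residue x n + of_bool (bit (residue x (Suc n)) n) * 2 ^ n"
      using take_bit_Suc_from_most[of n "residue x (Suc n)"] residue_Suc_mod[of x n]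
        residue_mod[of x "Suc n"]
      by (simp add: take_bit_eq_mod ac_simps del: residue_mod power_Suc)
    then have "(of_int (residue x (Suc n)) :: two_adic) =
        of_int (residue x n + of_bool (bit (residue x (Suc n)) n) * 2 ^ n)"
      by (rule arg_cong)
    then show ?case unfolding sum.lessThan_Suc Suc.IH
      by (simp add: two_adic_bit_def)
  qed
  have "2 ^ n dvd of_int (residue x k) - x" if "n \<le> k" for n k
    using that residue_mod_le[of n k x]
    by (simp add: two_power_dvd_two_adic_iff minus_two_adic.rep_eq residue_of_int)
  then show ?thesis
    unfolding sums_def partial tendsto_two_adic_iff
    by (metis (no_types, lifting) eventually_sequentiallyI)
qed

definition nu :: "nat \<Rightarrow> nat" where
  "nu n = multiplicity 2 n"

definition od :: "nat \<Rightarrow> nat" where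
  "od n = n div 2 ^ nu n"

text \<open>The 2-adic integer \<open>z\<close>.\<close>

definition od_fact_lim :: two_adic where
  "od_fact_lim = lim (\<lambda>e. of_nat (od (fact (2 ^ e))))"

definition uns :: "nat \<Rightarrow> nat \<Rightarrow> nat" where
  "uns e d = (\<Sum>i<d. of_bool (bit (od (fact (2 ^ e))) (e + 1 + i)) * 2 ^ i)"

text \<open>As in \<open>stab (e + 1) d\<close>, the first argument is the position of the lowest bit used.\<close>

definition stab :: "nat \<Rightarrow> nat \<Rightarrow> nat" where
  "stab p d = (\<Sum>i<d. of_bool (two_adic_bit od_fact_lim (p + i)) * 2 ^ i)"

end

theory Submission
  imports Defs "HOL-Number_Theory.Cong"
begin

text \<open>
  Let \<open>A\<^sub>e\<close> be the odd part of \<open>(2 ^ e)!\<close> and \<open>P\<^sub>e\<close> the product of the odd numbers below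
  \<open>2 ^ (e + 1)\<close>, so that \<open>A\<^sub>e\<^sub>+\<^sub>1 = A\<^sub>e P\<^sub>e\<close>. Since \<open>A\<^sub>e\<close> and \<open>z\<close> agree modulo \<open>2 ^ (e + 1)\<close>, the
  quantity \<open>stab (e + 1) d - uns e d\<close> is \<open>K\<^sub>e = (z - A\<^sub>e) / 2 ^ (e + 1)\<close> modulo \<open>2 ^ d\<close>, and it
  suffices that \<open>K\<^sub>e\<^sub>+\<^sub>1\<close> and \<open>K\<^sub>e\<close> agree modulo \<open>2 ^ e\<close>, that is,
  \<open>z + A\<^sub>e\<^sub>+\<^sub>1 \<equiv> 2 A\<^sub>e\<close> modulo \<open>2 ^ (2 e + 2)\<close>. Modulo the same power \<open>P\<^sub>e\<^sub>+\<^sub>1 \<equiv> P\<^sub>e\<^sup>2\<close>, which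
  gives \<open>z P\<^sub>e \<equiv> A\<^sub>e\<close>; so \<open>P\<^sub>e\<close> times the difference of the two sides is
  \<open>A\<^sub>e (P\<^sub>e - 1)\<^sup>2\<close>, which vanishes because \<open>P\<^sub>e \<equiv> 1\<close> modulo \<open>2 ^ (e + 1)\<close>.
\<close>

section \<open>Products of consecutive odd numbers\<close>

definition odd_prod :: "nat \<Rightarrow> int" where
  "odd_prod n = (\<Prod>i<n. 2 * int i + 1)"

lemma odd_odd_prod: "odd (odd_prod n)"
  by (induction n) (simp_all add: odd_prod_def)

text \<open>First-order expansion in \<open>x\<close>. A single \<open>s\<close>, the sum of the
  products omitting one factor, serves both signs, so knowledge of the shift by \<open>- x\<close>
  transfers to the shift by \<open>x\<close>.\<close>

lemma prod_shift_expansion: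
  fixes f :: "'a \<Rightarrow> int"
  assumes "finite A"
  shows "\<exists>s. [(\<Prod>i\<in>A. f i + x) = (\<Prod>i\<in>A. f i) + x * s] (mod x\<^sup>2) \<and>
    [(\<Prod>i\<in>A. f i - x) = (\<Prod>i\<in>A. f i) - x * s] (mod x\<^sup>2)"
  using assms
proof (induction A)
  case empty
  show ?case by (rule exI[of _ 0]) simp
next
  case (insert a A)
  define p where "p = (\<Prod>i\<in>A. f i)"
  from insert.IH obtain s where
    plus: "[(\<Prod>i\<in>A. f i + x) = p + x * s] (mod x\<^sup>2)" and
    minus: "[(\<Prod>i\<in>A. f i - x) = p - x * s] (mod x\<^sup>2)"
    unfolding p_def by blast
  have "[(f a + x) * (\<Prod>i\<in>A. f i + x) = (f a + x) * (p + x * s)] (mod x\<^sup>2)"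
    using plus by (rule cong_scalar_left)
  also have "(f a + x) * (p + x * s) = f a * p + x * (p + f a * s) + x\<^sup>2 * s"
    by (simp add: algebra_simps power2_eq_square)
  also have "[\<dots> = f a * p + x * (p + f a * s)] (mod x\<^sup>2)"
    by (simp add: cong_iff_dvd_diff)
  finally have 1: "[(f a + x) * (\<Prod>i\<in>A. f i + x) = f a * p + x * (p + f a * s)] (mod x\<^sup>2)" .
  have "[(f a - x) * (\<Prod>i\<in>A. f i - x) = (f a - x) * (p - x * s)] (mod x\<^sup>2)"
    using minus by (rule cong_scalar_left)
  also have "(f a - x) * (p - x * s) = f a * p - x * (p + f a * s) + x\<^sup>2 * s"
    by (simp add: algebra_simps power2_eq_square)
  also have "[\<dots> = f a * p - x * (p + f a * s)] (mod x\<^sup>2)"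
    by (simp add: cong_iff_dvd_diff)
  finally have 2: "[(f a - x) * (\<Prod>i\<in>A. f i - x) = f a * p - x * (p + f a * s)] (mod x\<^sup>2)" .
  show ?case
    using 1 2 insert.hyps by (auto simp: p_def)
qed

lemma odd_prod_double:
  assumes "even n"
  shows "[odd_prod (2 * n) = (odd_prod n)\<^sup>2] (mod (2 * int n)\<^sup>2)"
proof -
  let ?x = "2 * int n"
  have odd_prod_add: "odd_prod (n + k) = odd_prod n * (\<Prod>i<k. (2 * int i + 1) + ?x)" for k
  proof (induction k)
    case (Suc k)
    have "odd_prod (n + Suc k) = odd_prod (n + k) * ((2 * int k + 1) + ?x)"
      by (simp add: odd_prod_def)
    then show ?case by (metis Suc.IH prod.lessThan_Suc mult.assoc)
  qed simp
  \<comment> \<open>The map \<open>a \<mapsto> 2n - a\<close> permutes the odd numbers below \<open>2n\<close>, so shifting the factors by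
    \<open>- 2n\<close> preserves the product; hence the linear term in the shift vanishes modulo \<open>(2n)\<^sup>2\<close>.\<close>
  have "(\<Prod>i<n. (2 * int i + 1) - ?x) = (\<Prod>i<n. (2 * int (n - Suc i) + 1) - ?x)"
    by (rule prod.nat_diff_reindex[symmetric])
  also have "\<dots> = (\<Prod>i<n. - (2 * int i + 1))"
    by (rule prod.cong) (simp_all add: of_nat_diff)
  \<comment> \<open>The sign (-1)^n disappears because \<open>n\<close> is even.\<close>
  also have "\<dots> = odd_prod n"
    using assms by (simp only: odd_prod_def prod_uminus card_lessThan) simp
  finally have reflect: "(\<Prod>i<n. (2 * int i + 1) - ?x) = odd_prod n" .
  obtain s where
    plus: "[(\<Prod>i<n. (2 * int i + 1) + ?x) = odd_prod n + ?x * s] (mod ?x\<^sup>2)" and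
    minus: "[odd_prod n = odd_prod n - ?x * s] (mod ?x\<^sup>2)"
    using prod_shift_expansion[of "{..<n}" "\<lambda>i. 2 * int i + 1" ?x]
    unfolding reflect odd_prod_def[symmetric] using finite_lessThan by blast
  from minus have "[odd_prod n + ?x * s = odd_prod n] (mod ?x\<^sup>2)"
    by (simp add: cong_iff_dvd_diff)
  with plus have "[(\<Prod>i<n. (2 * int i + 1) + ?x) = odd_prod n] (mod ?x\<^sup>2)"
    by (rule cong_trans)
  from cong_scalar_left[OF this, of "odd_prod n"] show ?thesis
    using odd_prod_add[of n] by (simp only: mult_2[of n] power2_eq_square[of "odd_prod n"])
qed

lemma odd_prod_pow2_Suc:
  assumes "1 \<le> e"
  shows "[odd_prod (2 ^ Suc e) = (odd_prod (2 ^ e))\<^sup>2] (mod 2 ^ (2 * e + 2))"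
proof -
  have "(2 * int (2 ^ e))\<^sup>2 = 2 ^ (2 * e + 2)"
    by (simp add: power_mult_distrib power_mult[symmetric] power_add mult.commute)
  then show ?thesis
    using odd_prod_double[of "2 ^ e"] assms by simp
qed

text \<open>Squaring an odd p gains a factor 2, as p^2 - 1 = (p - 1)(p + 1). The induction starts
  from 1*3*5*7 = 105, which is 1 modulo 8; one step earlier, 1*3 is not 1 modulo 4.\<close>

lemma odd_prod_pow2_cong_1:
  assumes "2 \<le> e"
  shows "[odd_prod (2 ^ e) = 1] (mod 2 ^ Suc e)"
  using assms
proof (induction e rule: dec_induct)
  case base
  show ?case by (simp add: odd_prod_def eval_nat_numeral cong_def)
next
  case (step e)
  have "2 ^ Suc e dvd odd_prod (2 ^ e) - 1"
    using step.IH by (simp add: cong_iff_dvd_diff)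
  moreover have "2 dvd odd_prod (2 ^ e) + 1"
    using odd_odd_prod[of "2 ^ e"] by simp
  ultimately have "2 ^ Suc e * 2 dvd (odd_prod (2 ^ e) - 1) * (odd_prod (2 ^ e) + 1)"
    by (rule mult_dvd_mono)
  then have "[(odd_prod (2 ^ e))\<^sup>2 = 1] (mod 2 ^ Suc (Suc e))"
    by (simp add: cong_iff_dvd_diff algebra_simps power2_eq_square)
  moreover have "[odd_prod (2 ^ Suc e) = (odd_prod (2 ^ e))\<^sup>2] (mod 2 ^ Suc (Suc e))"
    using step.hyps
    by (intro cong_dvd_modulus[OF odd_prod_pow2_Suc])
      (simp_all add: le_imp_power_dvd del: power_Suc)
  ultimately show ?case by (metis cong_trans)
qed

section \<open>The odd part of \<open>(2 ^ e)!\<close>\<close>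

abbreviation od_fact :: "nat \<Rightarrow> int" where
  "od_fact e \<equiv> int (od (fact (2 ^ e)))"

lemma od_pow2_mult:
  assumes "odd m"
  shows "od (2 ^ k * m) = m"
proof -
  have "nu (2 ^ k * m) = k"
    unfolding nu_def using assms by (intro multiplicity_eqI) simp_all
  then show ?thesis by (simp add: od_def)
qed

lemma nat_pow2_odd_decomp:
  assumes "0 < n"
  shows "n = 2 ^ nu n * od n" and "odd (od n)"
  using multiplicity_decompose[of n 2] assms
  by (simp_all add: od_def nu_def multiplicity_dvd)

lemma fact_double: "int (fact (2 * n)) = 2 ^ n * odd_prod n * int (fact n)"
  by (induction n) (simp_all add: odd_prod_def algebra_simps)

lemma odd_od_fact: "odd (od_fact e)"
  using nat_pow2_odd_decomp(2)[of "fact (2 ^ e)"] by simp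

lemma od_fact_Suc: "od_fact (Suc e) = od_fact e * odd_prod (2 ^ e)"
proof -
  define p where "p = nat (odd_prod (2 ^ e))"
  have "0 \<le> odd_prod (2 ^ e)"
    unfolding odd_prod_def by (rule prod_nonneg) simp
  then have p: "int p = odd_prod (2 ^ e)"
    by (simp add: p_def)
  then have "odd p"
    using odd_odd_prod[of "2 ^ e"] by (metis even_of_nat_iff)
  have f: "(fact (2 ^ e) :: nat) = 2 ^ nu (fact (2 ^ e)) * od (fact (2 ^ e))"
      and o: "odd (od (fact (2 ^ e)))"
    using nat_pow2_odd_decomp[of "fact (2 ^ e)"] by simp_all
  have "int (fact (2 ^ Suc e)) = int (2 ^ 2 ^ e * p * fact (2 ^ e))"
    using fact_double[of "2 ^ e"] by (simp add: p)
  then have "(fact (2 ^ Suc e) :: nat) = 2 ^ 2 ^ e * p * fact (2 ^ e)"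
    by (simp only: of_nat_eq_iff)
  also have "\<dots> = 2 ^ 2 ^ e * p * (2 ^ nu (fact (2 ^ e)) * od (fact (2 ^ e)))"
    by (subst f) (rule refl)
  also have "\<dots> = 2 ^ (2 ^ e + nu (fact (2 ^ e))) * (od (fact (2 ^ e)) * p)"
    by (simp add: power_add)
  finally have "od (fact (2 ^ Suc e)) = od (fact (2 ^ e)) * p"
    using o \<open>odd p\<close> by (simp only: od_pow2_mult even_mult_iff simp_thms)
  then show ?thesis by (simp add: p)
qed

lemma od_fact_Suc_cong:
  assumes "2 \<le> e"
  shows "[od_fact (Suc e) = od_fact e] (mod 2 ^ Suc e)"
  using cong_scalar_left[OF odd_prod_pow2_cong_1[OF assms], of "od_fact e"]
  by (simp add: od_fact_Suc del: power_Suc)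

lemma cong_cancel_odd:
  fixes a b c :: int
  assumes "odd c" "[a * c = b * c] (mod 2 ^ n)"
  shows "[a = b] (mod 2 ^ n)"
  using assms by (simp add: cong_mult_rcancel)

text \<open>
  If \<open>P\<^sub>j\<^sub>+\<^sub>1\<close> were exactly \<open>P\<^sub>j\<^sup>2\<close> for the factors \<open>P\<^sub>j\<close> = \<open>odd_prod (2 ^ j)\<close>, the infinite product
  of the \<open>P\<^sub>j\<close> with \<open>j \<ge> e\<close> would be \<open>P\<^sub>e\<close> to the power \<open>1 + 2 + 4 + \<dots> = - 1\<close>.
\<close>

lemma od_fact_mult_odd_prod_cong:
  assumes "1 \<le> e" "e \<le> N" "2 \<le> N" "r \<le> 2 * e + 2" "r \<le> Suc N"
  shows "[od_fact N * odd_prod (2 ^ e) = od_fact e] (mod 2 ^ r)"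
  using assms(2,1,4)
proof (induction e rule: inc_induct)
  case base
  have "[od_fact N * odd_prod (2 ^ N) = od_fact N] (mod 2 ^ Suc N)"
    using od_fact_Suc_cong[OF assms(3)] by (simp add: od_fact_Suc del: power_Suc)
  then show ?case
    using assms(5) by (meson cong_dvd_modulus le_imp_power_dvd)
next
  case (step e)
  let ?p = "odd_prod (2 ^ e)"
  have "[odd_prod (2 ^ Suc e) = ?p\<^sup>2] (mod 2 ^ r)"
    using step.prems
    by (intro cong_dvd_modulus[OF odd_prod_pow2_Suc])
      (simp_all add: le_imp_power_dvd del: power_Suc)
  then have "[od_fact N * odd_prod (2 ^ Suc e) = od_fact N * ?p\<^sup>2] (mod 2 ^ r)"
    by (rule cong_scalar_left)
  moreover have "[od_fact N * odd_prod (2 ^ Suc e) = od_fact (Suc e)] (mod 2 ^ r)"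
    using step.prems by (intro step.IH) simp_all
  ultimately have "[od_fact N * ?p\<^sup>2 = od_fact (Suc e)] (mod 2 ^ r)"
    by (rule cong_trans[OF cong_sym])
  \<comment> \<open>Descending from \<open>Suc e\<close> to \<open>e\<close> leaves a common factor
    \<open>?p\<close> on both sides, which is odd and hence cancels.\<close>
  then have "[od_fact N * ?p * ?p = od_fact e * ?p] (mod 2 ^ r)"
    by (simp only: od_fact_Suc power2_eq_square mult.assoc)
  then show ?case
    by (rule cong_cancel_odd[OF odd_odd_prod])
qed

text \<open>Here \<open>od_fact N\<close> stands in for z: the bound on \<open>N\<close> makes
  further odd parts agree with it modulo 2^(2e+2).\<close>

lemma od_fact_second_difference:
  assumes "2 \<le> e" "2 * e + 1 \<le> N"
  shows "[od_fact N + od_fact (Suc e) = 2 * od_fact e] (mod 2 ^ (2 * e + 2))"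
proof -
  let ?p = "odd_prod (2 ^ e)"
  have "2 ^ Suc e dvd ?p - 1"
    using odd_prod_pow2_cong_1[OF assms(1)] by (simp add: cong_iff_dvd_diff)
  then have "2 ^ Suc e * 2 ^ Suc e dvd (?p - 1) * (?p - 1)"
    by (intro mult_dvd_mono)
  moreover have "2 * e + 2 = Suc e + Suc e"
    by simp
  ultimately have "2 ^ (2 * e + 2) dvd (?p - 1) * (?p - 1)"
    by (simp only: power_add)
  then have "2 ^ (2 * e + 2) dvd od_fact e * ((?p - 1) * (?p - 1))"
    by (rule dvd_mult)
  moreover have "2 ^ (2 * e + 2) dvd od_fact N * ?p - od_fact e"
    using od_fact_mult_odd_prod_cong[of e N "2 * e + 2"] assms
    by (simp add: cong_iff_dvd_diff del: power_Suc)
  ultimately have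
    "2 ^ (2 * e + 2) dvd od_fact e * ((?p - 1) * (?p - 1)) + (od_fact N * ?p - od_fact e)"
    by (rule dvd_add)
  also have "\<dots> = (od_fact N + od_fact (Suc e)) * ?p - 2 * od_fact e * ?p"
    unfolding od_fact_Suc by (simp add: algebra_simps)
  finally show ?thesis
    unfolding cong_iff_dvd_diff[symmetric] by (rule cong_cancel_odd[OF odd_odd_prod])
qed

section \<open>Two-adic limits\<close>

lemma residue_eq_iff_dvd: "residue x n = residue y n \<longleftrightarrow> 2 ^ n dvd x - y"
proof -
  have "2 ^ n dvd x - y \<longleftrightarrow> (residue x n - residue y n) mod 2 ^ n = 0"
    by (simp add: two_power_dvd_two_adic_iff minus_two_adic.rep_eq)
  also have "\<dots> \<longleftrightarrow> residue x n mod 2 ^ n = residue y n mod 2 ^ n"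
    by (simp only: mod_eq_dvd_iff dvd_eq_mod_eq_0)
  finally show ?thesis by simp
qed

text \<open>Passing to the integer residue modulo 2^(m+n) reduces the cancellation to the
  integers.\<close>

lemma two_power_dvd_two_adic_cancel:
  assumes "2 ^ (m + n) dvd 2 ^ m * (x :: two_adic)"
  shows "2 ^ n dvd x"
proof -
  have "2 ^ (m + n) dvd 2 ^ m * residue x (m + n)"
    using assms by (simp add: two_power_dvd_two_adic_iff times_two_adic.rep_eq residue_two_power
        mod_simps dvd_eq_mod_eq_0)
  then have "2 ^ n dvd residue x (m + n)"
    by (simp add: power_add)
  then show ?thesis
    using residue_mod_le[of n "m + n" x] by (simp add: two_power_dvd_two_adic_iff)
qed

lemma two_adic_coherent_limit:
  fixes f :: "nat \<Rightarrow> int"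
  assumes "\<And>n. [f (Suc n) = f n] (mod 2 ^ n)"
  obtains x where "\<And>n. residue x n = f n mod 2 ^ n"
proof
  show "residue (Abs_two_adic (\<lambda>n. f n mod 2 ^ n)) n = f n mod 2 ^ n" for n
    using assms by (subst Abs_two_adic_inverse) (simp_all add: mod_pow_Suc_mod cong_def del: power_Suc)
qed

text \<open>The proof also establishes convergence, so \<open>lim\<close> in the definition of z
  denotes a genuine limit.\<close>

lemma residue_od_fact_lim: "residue od_fact_lim n = od_fact n mod 2 ^ n"
proof -
  have coherent: "[od_fact (Suc n) = od_fact n] (mod 2 ^ n)" for n
  proof (cases "2 \<le> n")
    case True
    from od_fact_Suc_cong[OF this] show ?thesis
      by (rule cong_dvd_modulus) simp
  next
    case False
    then have "n = 0 \<or> n = 1" by auto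
    then show ?thesis
      using odd_od_fact[of n] odd_od_fact[of "Suc n"]
      by (auto simp: cong_iff_dvd_diff simp del: of_nat_fact)
  qed
  from two_adic_coherent_limit[of od_fact, OF coherent]
  obtain x where x: "residue x n = od_fact n mod 2 ^ n" for n by blast
  have "2 ^ n dvd (of_nat (od (fact (2 ^ k))) :: two_adic) - x" if "n \<le> k" for n k
    using residue_mod_le[OF that, of x] that
    by (simp add: residue_eq_iff_dvd[symmetric] residue_of_nat x mod_mod_cancel le_imp_power_dvd)
  then have "(\<lambda>e. of_nat (od (fact (2 ^ e)))) \<longlonglongrightarrow> x"
    unfolding tendsto_two_adic_iff by (metis (no_types, lifting) eventually_sequentiallyI)
  then have "od_fact_lim = x"
    unfolding od_fact_lim_def by (rule limI)
  then show ?thesis using x[of n] by simp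
qed

lemma od_fact_lim_cong:
  assumes "2 \<le> e"
  shows "2 ^ Suc e dvd od_fact_lim - of_nat (od (fact (2 ^ e)))"
  using od_fact_Suc_cong[OF assms]
  by (simp add: residue_eq_iff_dvd[symmetric] residue_of_nat residue_od_fact_lim cong_def
      del: power_Suc)

lemma od_fact_lim_second_difference:
  assumes "2 \<le> e"
  shows "2 ^ (2 * e + 2) dvd
    od_fact_lim + of_nat (od (fact (2 ^ Suc e))) - 2 * of_nat (od (fact (2 ^ e)))"
proof -
  have "residue (2 * of_nat (od (fact (2 ^ e)))) n = 2 * od_fact e mod 2 ^ n" for n
    using residue_of_nat[of "2 * od (fact (2 ^ e))" n] by simp
  then show ?thesis
    using od_fact_second_difference[OF assms, of "2 * e + 2"]
    by (simp add: residue_eq_iff_dvd[symmetric] plus_two_adic.rep_eq residue_od_fact_lim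
        residue_of_nat cong_def mod_simps del: power_Suc)
qed

lemma od_fact_lim_deviation:
  obtains K :: two_adic where
    "\<And>d e. d < e \<Longrightarrow> 2 \<le> e \<Longrightarrow>
      2 ^ (e + 1 + d) dvd od_fact_lim - of_nat (od (fact (2 ^ e))) - 2 ^ (e + 1) * K"
proof -
  have "\<forall>e. \<exists>k. 2 \<le> e \<longrightarrow> od_fact_lim - of_nat (od (fact (2 ^ e))) = 2 ^ (e + 1) * k"
    using od_fact_lim_cong by (auto simp: dvd_def)
  then obtain k where k: "2 \<le> e \<Longrightarrow>
      od_fact_lim - of_nat (od (fact (2 ^ e))) = 2 ^ (e + 1) * k e" for e
    by metis
  have step: "2 ^ e dvd k e - k (Suc e)" if "2 \<le> e" for e
  proof -
    \<comment> \<open>Of the 2e+2 powers of 2 dividing the second difference, this scaling uses up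
      e+2, leaving e.\<close>
    have "2 ^ (e + 2) * (k e - k (Suc e)) = 2 * (2 ^ (e + 1) * k e) - 2 ^ (Suc e + 1) * k (Suc e)"
      by (simp add: algebra_simps)
    also have "\<dots> = 2 * (od_fact_lim - of_nat (od (fact (2 ^ e))))
        - (od_fact_lim - of_nat (od (fact (2 ^ Suc e))))"
      by (simp only: k[OF that] k[OF le_SucI[OF that]])
    also have "\<dots> = od_fact_lim + of_nat (od (fact (2 ^ Suc e))) - 2 * of_nat (od (fact (2 ^ e)))"
      by (simp add: algebra_simps)
    finally have eq: "2 ^ (e + 2) * (k e - k (Suc e)) =
        od_fact_lim + of_nat (od (fact (2 ^ Suc e))) - 2 * of_nat (od (fact (2 ^ e)))" .
    have "(e + 2) + e = 2 * e + 2"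
      by simp
    then have "2 ^ ((e + 2) + e) dvd 2 ^ (e + 2) * (k e - k (Suc e))"
      using od_fact_lim_second_difference[OF that] by (simp only: eq)
    then show ?thesis by (rule two_power_dvd_two_adic_cancel)
  qed
  have res: "residue (k e) n = residue (k (Suc e)) n" if "2 \<le> e" "n \<le> e" for n e
    using dvd_trans[OF le_imp_power_dvd[OF that(2)] step[OF that(1)]]
    by (simp add: residue_eq_iff_dvd)
  have const: "residue (k (n + 2)) n = residue (k e) n" if "n + 2 \<le> e" for n e
    using that by (induction e rule: dec_induct) (simp_all add: res[symmetric])
  \<comment> \<open>The index \<open>n + 2\<close> is at least 2 and at least \<open>n\<close>, so
    the residue modulo 2^n has already stabilized.\<close>
  define f where "f n = residue (k (n + 2)) n" for n
  have "[f (Suc n) = f n] (mod 2 ^ n)" for n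
    using res[of "n + 2" n] residue_Suc_mod[of "k (Suc (n + 2))" n]
    by (simp add: f_def cong_def)
  from two_adic_coherent_limit[of f, OF this]
  obtain K where K: "residue K n = f n mod 2 ^ n" for n by blast
  show ?thesis
  proof (rule that)
    fix d e :: nat
    assume de: "d < e" "2 \<le> e"
    \<comment> \<open>Stability is stated from index \<open>d + 2\<close> on, while
      \<open>d < e\<close> only gives \<open>d + 1 \<le> e\<close>; moving to \<open>Suc e\<close>
      closes the gap.\<close>
    have "residue (k e) d = residue (k (Suc e)) d"
      using de by (intro res) simp_all
    also have "\<dots> = residue K d"
      using const[of d "Suc e"] de by (simp add: K f_def)
    finally have "2 ^ d dvd k e - K"
      by (simp add: residue_eq_iff_dvd)
    then have "2 ^ (e + 1) * 2 ^ d dvd 2 ^ (e + 1) * (k e - K)"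
      by (intro mult_dvd_mono) simp_all
    then show "2 ^ (e + 1 + d) dvd
        od_fact_lim - of_nat (od (fact (2 ^ e))) - 2 ^ (e + 1) * K"
      using k[OF de(2)] by (simp add: right_diff_distrib power_add mult.assoc)
  qed
qed

section \<open>Blocks of bits\<close>

lemma sum_bits_eq:
  "(\<Sum>i<d. of_bool (bit (a :: int) (p + i)) * 2 ^ i) = a div 2 ^ p mod 2 ^ d"
proof -
  have "a div 2 ^ p mod 2 ^ d = take_bit d (drop_bit p a)"
    by (simp add: take_bit_eq_mod drop_bit_eq_div)
  then show ?thesis
    by (simp add: take_bit_sum bit_drop_bit_eq push_bit_eq_mult atLeast0LessThan)
qed

lemma uns_eq: "int (uns e d) = od_fact e div 2 ^ (e + 1) mod 2 ^ d"
  unfolding sum_bits_eq[symmetric] by (simp add: uns_def bit_of_nat_iff_bit)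

text \<open>All bits involved lie below position \<open>p + d\<close>, so one residue determines
  them.\<close>

lemma stab_eq: "int (stab p d) = residue od_fact_lim (p + d) div 2 ^ p mod 2 ^ d"
proof -
  have "two_adic_bit x (p + i) \<longleftrightarrow> bit (residue x (p + d)) (p + i)" if "i < d" for x i
  proof -
    have "residue x (Suc (p + i)) = take_bit (Suc (p + i)) (residue x (p + d))"
      using residue_mod_le[of "Suc (p + i)" "p + d" x] that by (simp add: take_bit_eq_mod)
    then show ?thesis by (simp add: two_adic_bit_def bit_take_bit_iff)
  qed
  then show ?thesis
    unfolding sum_bits_eq[symmetric] by (simp add: stab_def)
qed

theorem theorem1p1:
  "\<exists>K :: two_adic. \<forall>d e :: nat. 0 < d \<and> d < e \<longrightarrow>
     2 ^ d dvd (of_nat (uns e d) + K) - of_nat (stab (e + 1) d)"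
proof -
  obtain K where K: "d < e \<Longrightarrow> 2 \<le> e \<Longrightarrow>
      2 ^ (e + 1 + d) dvd od_fact_lim - of_nat (od (fact (2 ^ e))) - 2 ^ (e + 1) * K" for d e
    using od_fact_lim_deviation by blast
  have "2 ^ d dvd (of_nat (uns e d) + K) - of_nat (stab (e + 1) d)" if "0 < d" "d < e" for d e
  proof -
    define a where "a = od_fact e"
    define b where "b = residue od_fact_lim (e + 1 + d)"
    let ?M = "2 ^ (e + 1) :: int"
    have "2 \<le> e" using that by simp
    have "residue od_fact_lim (e + 1) = residue (of_nat (od (fact (2 ^ e)))) (e + 1)"
      using od_fact_lim_cong[OF \<open>2 \<le> e\<close>] by (simp add: residue_eq_iff_dvd)
    \<comment> \<open>Equal low parts mean that no borrow occurs: \<open>b - a\<close> is exactly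
      \<open>?M\<close> times the difference of the quotients.\<close>
    then have low: "b mod ?M = a mod ?M"
      using residue_mod_le[of "e + 1" "e + 1 + d" od_fact_lim]
      by (simp add: a_def b_def residue_of_nat del: power_Suc)
    have "of_int b - of_nat (od (fact (2 ^ e))) - 2 ^ (e + 1) * K =
      (od_fact_lim - of_nat (od (fact (2 ^ e))) - 2 ^ (e + 1) * K) - (od_fact_lim - of_int b)"
      by simp
    moreover have "2 ^ (e + 1 + d) dvd od_fact_lim - of_int b"
      by (simp add: residue_eq_iff_dvd[symmetric] residue_of_int b_def del: power_Suc)
    ultimately have "2 ^ (e + 1 + d) dvd of_int b - of_nat (od (fact (2 ^ e))) - 2 ^ (e + 1) * K"
      using K[OF that(2) \<open>2 \<le> e\<close>] by (metis dvd_diff)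
    moreover have "b - a = ?M * (b div ?M - a div ?M)"
      using low mult_div_mod_eq[of ?M a] mult_div_mod_eq[of ?M b]
      by (simp only: right_diff_distrib)
    then have "(of_int (b - a) :: two_adic) = of_int (?M * (b div ?M - a div ?M))"
      by (rule arg_cong)
    then have "(of_int b - of_int a :: two_adic) = 2 ^ (e + 1) * of_int (b div ?M - a div ?M)"
      by (simp only: of_int_diff of_int_mult of_int_power of_int_numeral)
    ultimately have "2 ^ ((e + 1) + d) dvd 2 ^ (e + 1) * (of_int (b div ?M - a div ?M) - K)"
      by (simp add: a_def right_diff_distrib)
    then have "2 ^ d dvd of_int (b div ?M - a div ?M) - K"
      by (rule two_power_dvd_two_adic_cancel)
    then have "residue K d = (b div ?M - a div ?M) mod 2 ^ d"
      by (simp only: residue_eq_iff_dvd[symmetric] residue_of_int)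
    then have "residue (of_nat (uns e d) + K) d = residue (of_nat (stab (e + 1) d)) d"
      using uns_eq[of e d] stab_eq[of "e + 1" d]
      by (simp add: plus_two_adic.rep_eq residue_of_nat a_def b_def mod_simps del: power_Suc)
    then show ?thesis
      by (simp add: residue_eq_iff_dvd)
  qed
  then show ?thesis by blast
qed

end
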